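(* Let $G=(V,E)$ be a connected graph without multiedges or self-loops. Then $G$ has a flexible assignment on the sphere if and only if $G$ admits a NAP-coloring.
   Context: Let $S^2_{\mathbb{C}}=\{(x,y,z)\in\mathbb{C}^3 : x^2+y^2+z^2=1\}$. For $T,U\in S^2_{\mathbb{C}}$ put $\langle T,U\rangle=\sum_{i=1}^3 T_iU_i$ and define the spherical distance $d_{S^2}(T,U)=\frac{1-\langle T,U\rangle}{2}$. A realization of $G$ is a map $\rho\colon V\to S^2_{\mathbb{C}}$. Given an assignment $\lambda\colon E\to\mathbb{C}\setminus\{0,1\}$, a realization $\rho$ is compatible with $\lambda$ if $d_{S^2}(\rho(a),\rho(b))=\lambda(\{a,b\})$ for all $\{a,b\}\in E$ (non-adjacent vertices may coincide or be antipodal). Two realizations $\rho_1,\rho_2$ are essentially distinct if there is no $\sigma\in\mathrm{SO}_3(\mathbb{C})=\{\sigma\in\mathbb{C}^{3\times3}:\sigma\sigma^t=\sigma^t\sigma=\mathrm{id},\ \det\sigma=1\}$ with $\rho_1=\sigma\circ\rho_2$. The assignment $\lambda$ is a flexible assignment (on the sphere) if there are infinitely many pairwise essentially distinct realizations compatible with $\lambda$. A coloring $\varepsilon\colon E\to\{\text{red},\text{blue}\}$ is a NAP-coloring if it is surjective and there is no alternating path, where a path $(v,w,z,t)$ in $G$ (with edges $\{v,w\},\{w,z\},\{z,t\}$) is alternating if $\{v,w\}$ and $\{z,t\}$ have the same color and $\{w,z\}$ has the other color. *)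

theory Defs
  imports "HOL-Analysis.Analysis"
begin

definition simple_graph :: "'v set \<Rightarrow> 'v set set \<Rightarrow> bool" where
  "simple_graph V E \<longleftrightarrow>
     finite V \<and> (\<forall>e\<in>E. \<exists>a\<in>V. \<exists>b\<in>V. a \<noteq> b \<and> e = {a, b})"

definition connected_graph :: "'v set \<Rightarrow> 'v set set \<Rightarrow> bool" where
  "connected_graph V E \<longleftrightarrow>
     (\<forall>a\<in>V. \<forall>b\<in>V. (a, b) \<in> {(u, v). {u, v} \<in> E}\<^sup>*)"

text \<open>The bilinear (not Hermitian) form, which is different from the library's inner product.\<close>

definition bilin :: "complex ^ 3 \<Rightarrow> complex ^ 3 \<Rightarrow> complex" where
  "bilin T U = (\<Sum>i\<in>UNIV. T $ i * U $ i)"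

definition sphere2C :: "(complex ^ 3) set" where
  "sphere2C = {T. (T $ 1)\<^sup>2 + (T $ 2)\<^sup>2 + (T $ 3)\<^sup>2 = 1}"

definition sph_dist :: "complex ^ 3 \<Rightarrow> complex ^ 3 \<Rightarrow> complex" where
  "sph_dist T U = (1 - bilin T U) / 2"

definition SO3C :: "(complex ^ 3 ^ 3) set" where
  "SO3C = {\<sigma>. \<sigma> ** transpose \<sigma> = mat 1 \<and> transpose \<sigma> ** \<sigma> = mat 1 \<and> det \<sigma> = 1}"

text \<open>Maps defined on the vertices or on the edges are total functions of which only the values
  on \<open>V\<close> or \<open>E\<close> are ever inspected.\<close>

definition realization :: "'v set \<Rightarrow> ('v \<Rightarrow> complex ^ 3) \<Rightarrow> bool" where
  "realization V \<rho> \<longleftrightarrow> (\<forall>v\<in>V. \<rho> v \<in> sphere2C)"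

definition assignment :: "'v set set \<Rightarrow> ('v set \<Rightarrow> complex) \<Rightarrow> bool" where
  "assignment E lam \<longleftrightarrow> (\<forall>e\<in>E. lam e \<notin> {0, 1})"

definition compatible :: "'v set set \<Rightarrow> ('v set \<Rightarrow> complex) \<Rightarrow> ('v \<Rightarrow> complex ^ 3) \<Rightarrow> bool" where
  "compatible E lam \<rho> \<longleftrightarrow> (\<forall>a b. {a, b} \<in> E \<longrightarrow> sph_dist (\<rho> a) (\<rho> b) = lam {a, b})"

definition essentially_distinct ::
  "'v set \<Rightarrow> ('v \<Rightarrow> complex ^ 3) \<Rightarrow> ('v \<Rightarrow> complex ^ 3) \<Rightarrow> bool" where
  "essentially_distinct V \<rho>\<^sub>1 \<rho>\<^sub>2 \<longleftrightarrow> \<not> (\<exists>\<sigma>\<in>SO3C. \<forall>v\<in>V. \<rho>\<^sub>1 v = \<sigma> *v \<rho>\<^sub>2 v)"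

definition flexible_assignment ::
  "'v set \<Rightarrow> 'v set set \<Rightarrow> ('v set \<Rightarrow> complex) \<Rightarrow> bool" where
  "flexible_assignment V E lam \<longleftrightarrow>
     assignment E lam \<and>
     (\<exists>R. infinite R \<and> (\<forall>\<rho>\<in>R. realization V \<rho> \<and> compatible E lam \<rho>) \<and>
          pairwise (essentially_distinct V) R)"

datatype color = Red | Blue

text \<open>The end points \<open>v\<close> and \<open>t\<close> of an alternating path may coincide, so that in the absence of
  alternating paths every triangle is monochromatic. All other coincidences among the four
  vertices are excluded by the colors.\<close>

definition alternating_path ::
  "'v set set \<Rightarrow> ('v set \<Rightarrow> color) \<Rightarrow> 'v \<Rightarrow> 'v \<Rightarrow> 'v \<Rightarrow> 'v \<Rightarrow> bool" where
  "alternating_path E \<epsilon> v w z t \<longleftrightarrow>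
     {v, w} \<in> E \<and> {w, z} \<in> E \<and> {z, t} \<in> E \<and>
     \<epsilon> {v, w} = \<epsilon> {z, t} \<and> \<epsilon> {w, z} \<noteq> \<epsilon> {v, w}"

definition NAP_coloring :: "'v set set \<Rightarrow> ('v set \<Rightarrow> color) \<Rightarrow> bool" where
  "NAP_coloring E \<epsilon> \<longleftrightarrow> \<epsilon> ` E = UNIV \<and> \<not> (\<exists>v w z t. alternating_path E \<epsilon> v w z t)"

end

theory Submission
  imports Defs "HOL-Library.Function_Algebras" "HOL-Computational_Algebra.Polynomial"
begin

text \<open>Suppose that a flexible assignment exists. Normalising an edge and walking along the connected
  graph, one finds a path \<open>p, q, s\<close> and infinitely many compatible realizations in which \<open>q\<close> is the
  north pole, \<open>p\<close> is fixed and the isotropic coordinate \<open>t = x + iy\<close> of \<open>s\<close> takes infinitely many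
  values. In the ring of complex sequences, \<open>t\<close> is then transcendental over the constants, so there is
  a valuation that is trivial on the constants and positive at \<open>t\<close>: its ring is a maximal subring in
  which \<open>t\<close> is not invertible. A point of the sphere is a pair of points of the projective line, and
  the spherical distance of two such points is a cross-ratio. As it is a constant different from 0 and
  1, the four points of an edge cannot be split evenly by the open unit disc of the valuation. Color an
  edge red if at least three of its four points lie in the disc, and blue otherwise. Then there is no
  alternating path, and \<open>qs\<close> is red while \<open>pq\<close> is blue.\<close>

subsection \<open>Extending valuations in commutative rings\<close>

locale subring =
  fixes A :: "'a::comm_ring_1 set"
  assumes one_closed: "1 \<in> A"
    and diff_closed: "x \<in> A \<Longrightarrow> y \<in> A \<Longrightarrow> x - y \<in> A"
    and mult_closed: "x \<in> A \<Longrightarrow> y \<in> A \<Longrightarrow> x * y \<in> A"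
begin

lemma zero_closed: "0 \<in> A"
  using diff_closed[OF one_closed one_closed] by simp

lemma add_closed: "x \<in> A \<Longrightarrow> y \<in> A \<Longrightarrow> x + y \<in> A"
  using diff_closed[of x "0 - y"] diff_closed[OF zero_closed, of y] by simp

lemma power_closed: "x \<in> A \<Longrightarrow> x ^ n \<in> A"
  by (induction n) (simp_all add: one_closed mult_closed)

lemma of_nat_closed: "of_nat n \<in> A"
  by (induction n) (simp_all add: zero_closed one_closed add_closed)

lemma sum_closed: "(\<And>k. k \<in> K \<Longrightarrow> f k \<in> A) \<Longrightarrow> sum f K \<in> A"
  by (induction K rule: infinite_finite_induct) (simp_all add: zero_closed add_closed)

end

lemma power_mult_poly_inverse:
  fixes x y :: "'a::comm_ring_1"
  assumes "x * y = 1" "degree q \<le> n"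
  shows "x ^ n * poly q y = (\<Sum>j\<le>degree q. coeff q j * x ^ (n - j))"
proof -
  have "x ^ n * y ^ j = x ^ (n - j)" if "j \<le> degree q" for j
  proof -
    have "x ^ n = x ^ (n - j) * x ^ j" using that assms(2) by (simp flip: power_add)
    then have "x ^ n * y ^ j = x ^ (n - j) * (x * y) ^ j" by (simp add: power_mult_distrib mult.assoc)
    then show ?thesis by (simp add: assms(1))
  qed
  then show ?thesis by (simp add: poly_altdef sum_distrib_left mult.left_commute)
qed

definition polys_over :: "'a::comm_ring_1 set \<Rightarrow> 'a poly set" where
  "polys_over A = {p. \<forall>i. coeff p i \<in> A}"

definition adjoin :: "'a::comm_ring_1 set \<Rightarrow> 'a \<Rightarrow> 'a set" where
  "adjoin A x = (\<lambda>p. poly p x) ` polys_over A"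

definition unit_in :: "'a::comm_ring_1 set \<Rightarrow> 'a \<Rightarrow> bool" where
  "unit_in A t \<longleftrightarrow> (\<exists>a\<in>A. t * a = 1)"

context subring
begin

lemma monom_in_polys_over: "a \<in> A \<Longrightarrow> monom a n \<in> polys_over A"
  by (simp add: polys_over_def coeff_monom zero_closed)

lemma subring_polys_over: "subring (polys_over A)"
proof
  show "1 \<in> polys_over A"
    using monom_in_polys_over[OF one_closed, of 0] by (simp add: monom_0 one_pCons)
  fix p q assume "p \<in> polys_over A" "q \<in> polys_over A"
  then show "p - q \<in> polys_over A" "p * q \<in> polys_over A"
    by (simp_all add: polys_over_def coeff_mult diff_closed mult_closed sum_closed)
qed

lemma smult_in_polys_over: "a \<in> A \<Longrightarrow> p \<in> polys_over A \<Longrightarrow> smult a p \<in> polys_over A"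
  by (simp add: polys_over_def mult_closed)

lemma subring_adjoin: "subring (adjoin A x)"
proof -
  interpret P: subring "polys_over A" by (rule subring_polys_over)
  show ?thesis
  proof
    show "1 \<in> adjoin A x"
      unfolding adjoin_def by (rule image_eqI[OF _ P.one_closed]) simp
    fix b c assume "b \<in> adjoin A x" "c \<in> adjoin A x"
    then obtain p q where "p \<in> polys_over A" "q \<in> polys_over A"
      and evaluations: "b = poly p x" "c = poly q x"
      by (auto simp: adjoin_def)
    then have "p - q \<in> polys_over A" "p * q \<in> polys_over A"
      by (simp_all add: P.diff_closed P.mult_closed)
    then show "b - c \<in> adjoin A x" "b * c \<in> adjoin A x"
      unfolding adjoin_def evaluations by (auto intro: rev_image_eqI)
  qed
qed

lemma subset_adjoin: "A \<subseteq> adjoin A x"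
proof
  fix a assume "a \<in> A"
  then show "a \<in> adjoin A x"
    unfolding adjoin_def
    by (intro image_eqI[OF _ monom_in_polys_over[of a 0]]) (simp_all add: poly_monom)
qed

lemma generator_in_adjoin: "x \<in> adjoin A x"
  unfolding adjoin_def
  by (intro image_eqI[OF _ monom_in_polys_over[OF one_closed, of 1]]) (simp add: poly_monom)

text \<open>Since \<open>x * y = 1\<close>, the relation \<open>t * poly q y = 1\<close> expresses \<open>(1 - t * coeff q 0) * x ^ n\<close>,
  where \<open>n = degree p\<close>, by lower powers of \<open>x\<close>. This removes the leading term of \<open>p\<close> multiplied by
  that factor (Chevalley).\<close>

lemma inverse_of_smaller_degree:
  assumes coefficient: "t \<in> A" and inverse: "x * y = 1"
    and relation_x: "p \<in> polys_over A" "t * poly p x = 1"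
    and relation_y: "q \<in> polys_over A" "t * poly q y = 1"
    and degree: "degree q \<le> degree p" "0 < degree p"
  obtains r where "r \<in> polys_over A" "degree r < degree p" "t * poly r x = 1"
proof -
  interpret P: subring "polys_over A" by (rule subring_polys_over)
  let ?n = "degree p" and ?m = "degree q" and ?q\<^sub>0 = "coeff q 0"
  define head where "head = monom (lead_coeff p) ?n"
  define tail where "tail = (\<Sum>j=1..?m. monom (coeff q j) (?n - j))"
  define r where "r = monom ?q\<^sub>0 0 + smult (1 - t * ?q\<^sub>0) (p - head) + smult (t * lead_coeff p) tail"
  have "x ^ ?n * poly q y = ?q\<^sub>0 * x ^ ?n + poly tail x"
    using power_mult_poly_inverse[OF inverse degree(1)]
    by (simp add: tail_def poly_sum poly_monom sum.atMost_shift sum.atLeast1_atMost_eq)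
  then have "t * poly tail x = (t * poly q y - t * ?q\<^sub>0) * x ^ ?n" by (simp add: algebra_simps)
  then have tail_value: "t * poly tail x = (1 - t * ?q\<^sub>0) * x ^ ?n" by (simp add: relation_y(2))
  have "t * poly r x = t * ?q\<^sub>0 + (1 - t * ?q\<^sub>0) * (t * poly p x)
      + t * lead_coeff p * (t * poly tail x - (1 - t * ?q\<^sub>0) * x ^ ?n)"
    by (simp add: r_def head_def poly_monom algebra_simps)
  then have "t * poly r x = 1" by (simp add: relation_x(2) tail_value)
  moreover have "r \<in> polys_over A"
  proof -
    have "coeff p i \<in> A" "coeff q i \<in> A" for i
      using relation_x(1) relation_y(1) by (simp_all add: polys_over_def)
    then show ?thesis unfolding r_def head_def tail_def
      by (intro P.add_closed P.diff_closed P.sum_closed smult_in_polys_over monom_in_polys_over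
          relation_x(1) diff_closed mult_closed one_closed coefficient)
  qed
  moreover have "degree r < ?n"
  proof -
    have "coeff (p - head) i = 0" if "?n \<le> i" for i
      using that by (cases "i = ?n") (simp_all add: head_def coeff_monom coeff_eq_0)
    moreover have "coeff tail i = 0" if "?n \<le> i" for i
      using that degree(2) by (auto simp: tail_def coeff_sum coeff_monom intro!: sum.neutral)
    ultimately have "coeff r i = 0" if "?n \<le> i" for i
      using that degree(2) by (simp add: r_def coeff_monom)
    then show ?thesis using degree(2) by (meson degree_lessI)
  qed
  ultimately show thesis using that by blast
qed

lemma unit_in_of_adjoin_inverse_pair:
  assumes "t \<in> A" "x * y = 1" "unit_in (adjoin A x) t" "unit_in (adjoin A y) t"
  shows "unit_in A t"
proof -
  have "unit_in A t"
    if "p \<in> polys_over A" "q \<in> polys_over A" "t * poly p x = 1" "t * poly q y = 1" for p q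
    using that
  proof (induction "degree p + degree q" arbitrary: p q rule: less_induct)
    case less
    consider (zero_degree) "degree p = 0" | (reduce_p) "0 < degree p" "degree q \<le> degree p"
      | (reduce_q) "degree p < degree q" by linarith
    then show ?case
    proof cases
      case zero_degree
      then obtain a where "p = [:a:]" by (rule degree_eq_zeroE)
      moreover have "coeff p 0 \<in> A" using less.prems(1) by (simp add: polys_over_def)
      ultimately show ?thesis using less.prems(3) by (auto simp: unit_in_def)
    next
      case reduce_p
      with less.prems assms(1,2) obtain r
        where "r \<in> polys_over A" "degree r < degree p" "t * poly r x = 1"
        by (metis inverse_of_smaller_degree)
      then show ?thesis using less.hyps[of r q] less.prems by simp
    next
      case reduce_q
      have "y * x = 1" using assms(2) by (simp add: mult.commute)
      with reduce_q less.prems assms(1) obtain r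
        where "r \<in> polys_over A" "degree r < degree q" "t * poly r y = 1"
        by (metis inverse_of_smaller_degree less_imp_le neq0_conv not_less0)
      then show ?thesis using less.hyps[of p r] less.prems by simp
    qed
  qed
  then show ?thesis using assms(3,4) by (auto simp: unit_in_def adjoin_def)
qed

end

lemma subring_Union_chain:
  assumes "\<C> \<noteq> {}" and chain: "subset.chain {A. subring A} \<C>"
  shows "subring (\<Union>\<C>)"
proof
  have subring: "subring A" if "A \<in> \<C>" for A
    using chain that by (auto simp: subset_chain_def)
  show "1 \<in> \<Union>\<C>" using \<open>\<C> \<noteq> {}\<close> subring subring.one_closed by blast
  fix x y assume "x \<in> \<Union>\<C>" "y \<in> \<Union>\<C>"
  then obtain B C where "B \<in> \<C>" "x \<in> B" "C \<in> \<C>" "y \<in> C" by blast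
  moreover from this have "B \<subseteq> C \<or> C \<subseteq> B" using chain by (simp add: subset_chain_def)
  ultimately obtain A where member: "A \<in> \<C>" "x \<in> A" "y \<in> A" by blast
  then have "x - y \<in> A" "x * y \<in> A"
    using subring.diff_closed subring.mult_closed subring by metis+
  then show "x - y \<in> \<Union>\<C>" "x * y \<in> \<Union>\<C>" using member(1) by blast+
qed

lemma (in subring) maximal_subring_without_inverse:
  assumes "\<not> unit_in A t"
  obtains B where "subring B" "A \<subseteq> B" "\<not> unit_in B t"
    "\<And>C. subring C \<Longrightarrow> B \<subseteq> C \<Longrightarrow> \<not> unit_in C t \<Longrightarrow> C = B"
proof -
  define \<S> where "\<S> = {B. subring B \<and> A \<subseteq> B \<and> \<not> unit_in B t}"
  have "\<exists>B\<in>\<S>. \<forall>C\<in>\<S>. B \<subseteq> C \<longrightarrow> C = B"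
  proof (rule subset_Zorn_nonempty)
    show "\<S> \<noteq> {}" using assms subring_axioms by (auto simp: \<S>_def)
  next
    fix \<C> assume "\<C> \<noteq> {}" and chain: "subset.chain \<S> \<C>"
    moreover from chain have "subset.chain {B. subring B} \<C>"
      by (auto simp: subset_chain_def \<S>_def)
    ultimately have "subring (\<Union>\<C>)" by (simp add: subring_Union_chain)
    moreover have "A \<subseteq> \<Union>\<C>" "\<not> unit_in (\<Union>\<C>) t"
      using \<open>\<C> \<noteq> {}\<close> chain unfolding subset_chain_def \<S>_def unit_in_def by blast+
    ultimately show "\<Union>\<C> \<in> \<S>" by (simp add: \<S>_def)
  qed
  then obtain B where maximal: "B \<in> \<S>" "\<And>C. C \<in> \<S> \<Longrightarrow> B \<subseteq> C \<Longrightarrow> C = B" by blast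
  show thesis
  proof (rule that)
    fix C assume "subring C" "B \<subseteq> C" "\<not> unit_in C t"
    with maximal show "C = B" by (auto simp: \<S>_def)
  qed (use maximal(1) in \<open>simp_all add: \<S>_def\<close>)
qed

text \<open>The ambient ring will be a ring of functions, hence not a field: only pairs of mutually inverse
  elements are controlled by the valuation.\<close>

locale valuation_pair = subring +
  fixes M
  assumes ideal_subset: "M \<subseteq> A"
    and zero_in_ideal: "0 \<in> M"
    and ideal_add: "x \<in> M \<Longrightarrow> y \<in> M \<Longrightarrow> x + y \<in> M"
    and ideal_mult: "x \<in> A \<Longrightarrow> y \<in> M \<Longrightarrow> x * y \<in> M"
    and ideal_proper: "1 \<notin> M"
    and valuation: "x * y = 1 \<Longrightarrow> x \<in> A \<or> y \<in> M"

definition radical_of_multiples :: "'a::comm_ring_1 set \<Rightarrow> 'a \<Rightarrow> 'a set" where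
  "radical_of_multiples A t = {x \<in> A. \<exists>n. \<exists>a\<in>A. x ^ n = t * a}"

context subring
begin

lemma radical_of_multiples_add:
  assumes "x \<in> radical_of_multiples A t" "y \<in> radical_of_multiples A t"
  shows "x + y \<in> radical_of_multiples A t"
proof -
  obtain m n a b where x_power: "x \<in> A" "a \<in> A" "x ^ m = t * a"
    and y_power: "y \<in> A" "b \<in> A" "y ^ n = t * b"
    using assms by (auto simp: radical_of_multiples_def)
  have "\<exists>d\<in>A. of_nat (m + n choose i) * x ^ i * y ^ (m + n - i) = t * d" for i
  proof (cases "m \<le> i")
    case True
    then have "x ^ i = t * (a * x ^ (i - m))"
      by (metis x_power(3) le_add_diff_inverse power_add mult.assoc)
    then show ?thesis
      using x_power y_power
      by (intro bexI[of _ "of_nat (m + n choose i) * (a * x ^ (i - m)) * y ^ (m + n - i)"])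
        (simp_all add: mult_ac mult_closed power_closed of_nat_closed)
  next
    case False
    then have "m + n - i = n + (m - i)" by simp
    then have "y ^ (m + n - i) = t * (b * y ^ (m - i))"
      by (simp only: power_add y_power(3) mult.assoc)
    then show ?thesis
      using x_power y_power
      by (intro bexI[of _ "of_nat (m + n choose i) * x ^ i * (b * y ^ (m - i))"])
        (simp_all add: mult_ac mult_closed power_closed of_nat_closed)
  qed
  then obtain d where term_quotient: "\<And>i. d i \<in> A"
    "\<And>i. of_nat (m + n choose i) * x ^ i * y ^ (m + n - i) = t * d i"
    by metis
  have "(x + y) ^ (m + n) = t * (\<Sum>i\<le>m + n. d i)"
    by (simp add: binomial_ring term_quotient(2) sum_distrib_left)
  moreover have "(\<Sum>i\<le>m + n. d i) \<in> A" by (simp add: term_quotient(1) sum_closed)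
  ultimately show ?thesis
    using x_power(1) y_power(1) add_closed unfolding radical_of_multiples_def by blast
qed

lemma inverse_in_radical_of_multiples:
  assumes "x * y = 1" "y \<in> A" "unit_in (adjoin A x) t"
  shows "y \<in> radical_of_multiples A t"
proof -
  obtain p where relation: "p \<in> polys_over A" "t * poly p x = 1"
    using assms(3) by (auto simp: unit_in_def adjoin_def)
  have "y ^ degree p * poly p x = (\<Sum>i\<le>degree p. coeff p i * y ^ (degree p - i))"
    using assms(1) by (intro power_mult_poly_inverse) (simp_all add: mult.commute)
  also have "\<dots> \<in> A"
    using relation(1) assms(2)
    by (intro sum_closed mult_closed power_closed) (simp_all add: polys_over_def)
  finally have "y ^ degree p * poly p x \<in> A" .
  moreover have "y ^ degree p = t * (y ^ degree p * poly p x)"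
    using relation(2) by (metis mult.left_commute mult.right_neutral)
  ultimately show ?thesis using assms(2) unfolding radical_of_multiples_def by blast
qed

lemma valuation_pair_of_maximal_subring:
  assumes non_unit: "t \<in> A" "\<not> unit_in A t"
    and maximal: "\<And>B. subring B \<Longrightarrow> A \<subseteq> B \<Longrightarrow> \<not> unit_in B t \<Longrightarrow> B = A"
  shows "valuation_pair A (radical_of_multiples A t)"
proof
  show "radical_of_multiples A t \<subseteq> A" by (auto simp: radical_of_multiples_def)
  have "0 ^ 1 = t * 0" by simp
  then show "0 \<in> radical_of_multiples A t"
    unfolding radical_of_multiples_def using zero_closed by blast
  show "1 \<notin> radical_of_multiples A t"
    using non_unit(2) by (auto simp: radical_of_multiples_def unit_in_def)
  fix x y
  show "x + y \<in> radical_of_multiples A t"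
    if "x \<in> radical_of_multiples A t" "y \<in> radical_of_multiples A t"
    using that by (rule radical_of_multiples_add)
  show "x * y \<in> radical_of_multiples A t"
    if integral: "x \<in> A" and radical: "y \<in> radical_of_multiples A t"
  proof -
    obtain n a where "y \<in> A" "a \<in> A" "y ^ n = t * a"
      using radical by (auto simp: radical_of_multiples_def)
    moreover from this have "(x * y) ^ n = t * (x ^ n * a)" by (simp add: power_mult_distrib mult_ac)
    ultimately show ?thesis
      using integral mult_closed power_closed unfolding radical_of_multiples_def by blast
  qed
  show "x \<in> A \<or> y \<in> radical_of_multiples A t" if inverse: "x * y = 1"
  proof -
    have unit: "unit_in (adjoin A z) t" if "z \<notin> A" for z
      using maximal[OF subring_adjoin subset_adjoin] that generator_in_adjoin by metis
    have "x \<in> A \<or> y \<in> A"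
      using unit_in_of_adjoin_inverse_pair[OF non_unit(1) inverse] unit non_unit(2) by blast
    then show ?thesis using inverse_in_radical_of_multiples[OF inverse] unit by blast
  qed
qed

lemma valuation_pair_exists:
  assumes "t \<in> A" "\<not> unit_in A t"
  obtains B M where "valuation_pair B M" "A \<subseteq> B" "t \<in> M"
proof -
  obtain B where extension: "subring B" "A \<subseteq> B" "\<not> unit_in B t"
    and maximal: "\<And>C. subring C \<Longrightarrow> B \<subseteq> C \<Longrightarrow> \<not> unit_in C t \<Longrightarrow> C = B"
    using maximal_subring_without_inverse[OF assms(2)] by blast
  have "t \<in> B" using assms(1) extension(2) by blast
  then have "valuation_pair B (radical_of_multiples B t)"
    using subring.valuation_pair_of_maximal_subring extension(1,3) maximal by blast
  moreover have "t ^ 1 = t * 1" by simp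
  then have "t \<in> radical_of_multiples B t"
    unfolding radical_of_multiples_def using \<open>t \<in> B\<close> subring.one_closed[OF extension(1)] by blast
  ultimately show thesis using that extension(2) by blast
qed

end

subsection \<open>Valuations of points on the sphere\<close>

text \<open>Let \<open>u = x + iy\<close> and \<open>w = x - iy\<close> be the isotropic coordinates of a point \<open>(x, y, z)\<close> of the
  sphere, so that \<open>uw + z\<^sup>2 = 1\<close>. Then \<open>dominant A u z\<close> and \<open>dominant M w z\<close> (below: low and high) say
  that none or both, respectively, of the two points of the projective line attached to it lie in the
  open unit disc of the valuation. In the remaining case exactly one does.\<close>

definition dominant :: "'a::comm_ring_1 set \<Rightarrow> 'a \<Rightarrow> 'a \<Rightarrow> bool" where
  "dominant J u z \<longleftrightarrow> (\<exists>i. u * i = 1 \<and> i \<in> J \<and> z * i \<in> J)"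

definition zero_or_unit :: "'a::comm_ring_1 \<Rightarrow> bool" where
  "zero_or_unit x \<longleftrightarrow> x = 0 \<or> x dvd 1"

lemma sphere_equation_scaled:
  fixes u w z k :: "'a::comm_ring_1"
  assumes "u * w + z * z = 1"
  shows "(u * k) * (w * k) = k * k - (z * k) * (z * k)"
proof -
  have "(u * k) * (w * k) = (u * w + z * z) * (k * k) - (z * k) * (z * k)" by (simp add: algebra_simps)
  then show ?thesis by (simp add: assms)
qed

context valuation_pair
begin

lemma ideal_mult_right: "x \<in> M \<Longrightarrow> a \<in> A \<Longrightarrow> x * a \<in> M"
  using ideal_mult[of a x] by (simp add: mult.commute)

lemma ideal_diff: "x \<in> M \<Longrightarrow> y \<in> M \<Longrightarrow> x - y \<in> M"
  using ideal_add[of x "(0 - 1) * y"] ideal_mult[of "0 - 1" y] diff_closed[OF zero_closed one_closed]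
  by simp

lemma unit_inverse_in_ideal:
  assumes "zero_or_unit x" "x \<notin> A"
  obtains y where "x * y = 1" "y \<in> M"
proof -
  have "x \<noteq> 0" using assms(2) zero_closed by blast
  then obtain y where "x * y = 1" using assms(1) by (auto simp: zero_or_unit_def elim!: dvdE)
  then show thesis using valuation[of x y] assms(2) that by blast
qed

lemma unit_inverse_in_subring:
  assumes "zero_or_unit x" "x \<notin> M"
  obtains y where "x * y = 1" "y \<in> A"
proof -
  have "x \<noteq> 0" using assms(2) zero_in_ideal by blast
  then obtain y where "x * y = 1" using assms(1) by (auto simp: zero_or_unit_def elim!: dvdE)
  then show thesis using valuation[of y x] assms(2) that by (metis mult.commute)
qed

lemma not_dominant_integral:
  assumes "z \<in> A" "zero_or_unit u" "zero_or_unit w" "\<not> dominant A u z" "\<not> dominant M w z"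
  shows "u \<in> M" "w \<in> A"
proof -
  show "u \<in> M"
    using assms(1,2,4) mult_closed unit_inverse_in_subring[of u] unfolding dominant_def by metis
  show "w \<in> A"
    using assms(1,3,5) ideal_mult unit_inverse_in_ideal[of w] unfolding dominant_def by metis
qed

lemma dominant_of_scaled:
  assumes "J = A \<or> J = M" "z * k = 1" "k \<in> M" "w * k * l = 1" "l \<in> J"
  shows "dominant J w z"
  unfolding dominant_def
proof (intro exI[of _ "k * l"] conjI)
  show "w * (k * l) = 1" using assms(4) by (simp add: mult.assoc)
  show "k * l \<in> J" using assms(1,3,5) ideal_mult ideal_mult_right ideal_subset by blast
  have "z * (k * l) = l" using assms(2) by (simp flip: mult.assoc)
  then show "z * (k * l) \<in> J" using assms(5) by simp
qed

lemma sphere_trichotomy: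
  assumes sphere: "u * w + z * z = 1"
    and units: "zero_or_unit u" "zero_or_unit w" "zero_or_unit z"
    and not_dominant: "\<not> dominant A u z" "\<not> dominant M w z"
  shows "u \<in> M" "z \<in> A" "w \<in> A"
proof -
  show "z \<in> A"
  proof (rule ccontr)
    assume "z \<notin> A"
    then obtain k where inverse: "z * k = 1" "k \<in> M" using unit_inverse_in_ideal units(3) by blast
    have scaled: "zero_or_unit (x * k)" if "zero_or_unit x" for x
      using that inverse(1) unfolding zero_or_unit_def
      by (metis dvd_triv_right mult_zero_left mult_dvd_mono mult.right_neutral)
    have "u * k \<in> M"
      using dominant_of_scaled[of A z k u] inverse not_dominant(1)
        unit_inverse_in_subring scaled[OF units(1)]
      by metis
    moreover have "w * k \<in> A"
      using dominant_of_scaled[of M z k w] inverse not_dominant(2)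
        unit_inverse_in_ideal scaled[OF units(2)]
      by metis
    ultimately have "k * k - (u * k) * (w * k) \<in> M"
      using inverse(2) ideal_subset by (blast intro: ideal_diff ideal_mult_right)
    moreover have "k * k - (u * k) * (w * k) = 1"
      using sphere_equation_scaled[OF sphere, of k] inverse(1) by simp
    ultimately show False using ideal_proper by simp
  qed
  then show "u \<in> M" "w \<in> A" using not_dominant_integral units(1,2) not_dominant by blast+
qed

lemma high_low_not_adjacent:
  assumes "c \<in> A"
    and sphere: "u * w + z * z = 1" "u' * w' + z' * z' = 1"
    and edge: "2 * c = 2 * (z * z') + u * w' + w * u'"
    and high: "dominant M w z" and low: "dominant A u' z'"
  shows False
proof -
  obtain j where w_inverse: "w * j = 1" "j \<in> M" "z * j \<in> M" using high by (auto simp: dominant_def)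
  obtain i where u_inverse: "u' * i = 1" "i \<in> A" "z' * i \<in> A" using low by (auto simp: dominant_def)
  have "u * j = j * j - (z * j) * (z * j)"
    using sphere_equation_scaled[OF sphere(1), of j] w_inverse(1) by simp
  then have u_scaled: "u * j \<in> M"
    using w_inverse(2,3) ideal_subset ideal_diff ideal_mult by (metis subsetD)
  have "w' * i = i * i - (z' * i) * (z' * i)"
    using sphere_equation_scaled[OF sphere(2), of i] u_inverse(1) by simp
  then have w_scaled: "w' * i \<in> A" using u_inverse(2,3) by (simp add: diff_closed mult_closed)
  have two_closed: "2 \<in> A" using of_nat_closed[of 2] by simp
  have "1 = (w * j) * (u' * i)" using u_inverse w_inverse by simp
  also have "\<dots> = (2 * c - 2 * (z * z') - u * w') * i * j"
    unfolding edge by (simp add: algebra_simps)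
  also have "\<dots> = 2 * c * i * j - 2 * (z' * i) * (z * j) - (w' * i) * (u * j)"
    by (simp add: algebra_simps)
  also have "\<dots> \<in> M"
    by (intro ideal_diff ideal_mult mult_closed two_closed \<open>c \<in> A\<close>
        u_inverse(2,3) w_inverse(2,3) u_scaled w_scaled)
  finally show False using ideal_proper by simp
qed

text \<open>Modulo \<open>M\<close>, both \<open>z\<^sup>2\<close> and \<open>z'\<^sup>2\<close> are 1 and \<open>c\<close> is \<open>z * z'\<close>, hence so is \<open>c\<^sup>2\<close>.\<close>

lemma balanced_not_adjacent:
  assumes "c \<in> A" and two_unit: "unit_in A 2" and c_unit: "unit_in A (c * c - 1)"
    and sphere: "u * w + z * z = 1" "u' * w' + z' * z' = 1"
    and edge: "2 * c = 2 * (z * z') + u * w' + w * u'"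
    and balanced: "u \<in> M" "z \<in> A" "w \<in> A" "u' \<in> M" "z' \<in> A" "w' \<in> A"
  shows False
proof -
  obtain h where half_inverse: "2 * h = 1" "h \<in> A" using two_unit by (auto simp: unit_in_def)
  obtain d where c_inverse: "(c * c - 1) * d = 1" "d \<in> A" using c_unit by (auto simp: unit_in_def)
  define e where "e = h * (w' * u + w * u')"
  have e_small: "e \<in> M" unfolding e_def by (intro ideal_mult ideal_add half_inverse balanced)
  have "c = h * (2 * c)" using half_inverse(1) by (metis mult.assoc mult.commute mult.left_neutral)
  also have "\<dots> = (2 * h) * (z * z') + e"
    unfolding edge e_def by (simp add: algebra_simps)
  finally have expansion: "c = z * z' + e" using half_inverse(1) by simp
  have squares: "z * z = 1 - w * u" "z' * z' = 1 - w' * u'"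
    using sphere by (simp_all add: algebra_simps)
  have "c * c - 1 = (z * z) * (z' * z') - 1 + (c + z * z') * e"
    unfolding expansion by (simp add: algebra_simps)
  also have "\<dots> = (c + z * z') * e - w * u - (z * z) * (w' * u')"
    unfolding squares by (simp add: algebra_simps)
  also have "\<dots> \<in> M"
    by (intro ideal_diff ideal_mult add_closed mult_closed \<open>c \<in> A\<close> e_small balanced)
  finally have "1 \<in> M" using ideal_mult_right[OF _ c_inverse(2)] c_inverse(1) by metis
  then show False using ideal_proper by simp
qed

lemma dominant_of_small_conjugate:
  assumes "u * w + z * z = 1" "u \<in> M" "z \<in> A" "unit_in A (z * z - 1)"
  shows "dominant M w z"
proof -
  obtain d where inverse: "(z * z - 1) * d = 1" "d \<in> A" using assms(4) by (auto simp: unit_in_def)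
  have product: "w * u = 1 - z * z" using assms(1) by (simp add: algebra_simps)
  have "(w * u) * (0 - d) = (z * z - 1) * d" unfolding product by (simp add: algebra_simps)
  then have "w * (u * (0 - d)) = 1" by (simp add: inverse(1) mult.assoc)
  moreover have small: "u * (0 - d) \<in> M"
    using assms(2) inverse(2) by (intro ideal_mult_right diff_closed zero_closed)
  moreover have "z * (u * (0 - d)) \<in> M" using assms(3) small by (rule ideal_mult)
  ultimately show ?thesis unfolding dominant_def by blast
qed

end

text \<open>The middle edge of a red-blue-red path has a low end, which is also an end of a red edge whose
  other end is high; a blue-red-blue path is impossible since red edges have a high end and blue ones
  do not.\<close>

lemma NAP_coloring_from_marking:
  assumes not_adjacent: "\<And>a b. {a, b} \<in> E \<Longrightarrow> high a \<Longrightarrow> \<not> low b"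
    and covered: "\<And>a b. {a, b} \<in> E \<Longrightarrow> high a \<or> high b \<or> low a \<or> low b"
    and red: "{w, s} \<in> E" "high s" and blue: "{v, w} \<in> E" "\<not> high v" "\<not> high w"
  shows "\<exists>\<epsilon>. NAP_coloring E \<epsilon>"
proof -
  define \<epsilon> where "\<epsilon> e = (if \<exists>x\<in>e. high x then Red else Blue)" for e
  have "\<epsilon> {w, s} = Red" "\<epsilon> {v, w} = Blue" using red blue by (auto simp: \<epsilon>_def)
  then have "x \<in> \<epsilon> ` E" for x using red(1) blue(1) by (cases x) (auto intro: rev_image_eqI)
  then have "\<epsilon> ` E = UNIV" by blast
  moreover have "\<not> alternating_path E \<epsilon> a b c d" for a b c d
  proof
    assume path: "alternating_path E \<epsilon> a b c d"
    then have "{a, b} \<in> E" "{b, c} \<in> E" "{c, d} \<in> E" by (auto simp: alternating_path_def)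
    then show False
      using path covered[of b c] not_adjacent[of a b] not_adjacent[of c d] not_adjacent[of d c]
      by (auto simp: alternating_path_def \<epsilon>_def insert_commute split: if_splits)
  qed
  ultimately show ?thesis unfolding NAP_coloring_def by blast
qed

lemma (in valuation_pair) NAP_coloring_from_valued_realization:
  assumes edges_subset: "\<And>a b. {a, b} \<in> E \<Longrightarrow> a \<in> V \<and> b \<in> V"
    and sphere: "\<And>x. x \<in> V \<Longrightarrow> u x * w x + z x * z x = 1"
    and units: "\<And>x. x \<in> V \<Longrightarrow> zero_or_unit (u x) \<and> zero_or_unit (w x) \<and> zero_or_unit (z x)"
    and edge: "\<And>a b. {a, b} \<in> E \<Longrightarrow> 2 * c {a, b} = 2 * (z a * z b) + u a * w b + w a * u b"
    and lengths: "\<And>e. e \<in> E \<Longrightarrow> c e \<in> A \<and> unit_in A (c e * c e - 1)" and two_unit: "unit_in A 2"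
    and path: "{p, q} \<in> E" "{q, s} \<in> E"
    and integral: "w p \<in> A" "w q \<in> A" and dominant: "dominant M (w s) (z s)"
  shows "\<exists>\<epsilon>. NAP_coloring E \<epsilon>"
proof -
  define high low where "high x = dominant M (w x) (z x)" and "low x = dominant A (u x) (z x)" for x
  have not_high: "\<not> high x" if "w x \<in> A" for x
    using ideal_mult[OF that] ideal_proper unfolding high_def dominant_def by metis
  show ?thesis
  proof (rule NAP_coloring_from_marking)
    show "\<not> low b" if "{a, b} \<in> E" "high a" for a b
      using high_low_not_adjacent[OF _ sphere[of a] sphere[of b] edge[OF that(1)]]
        edges_subset[OF that(1)] lengths[OF that(1)] that(2)
      by (auto simp: high_def low_def)
    show "high a \<or> high b \<or> low a \<or> low b" if adjacent: "{a, b} \<in> E" for a b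
    proof (rule ccontr)
      assume neither: "\<not> (high a \<or> high b \<or> low a \<or> low b)"
      have vertices: "a \<in> V" "b \<in> V" using edges_subset[OF adjacent] by auto
      have not_dominant: "\<not> dominant A (u a) (z a)" "\<not> dominant M (w a) (z a)"
        "\<not> dominant A (u b) (z b)" "\<not> dominant M (w b) (z b)"
        using neither by (auto simp: high_def low_def)
      note balanced = sphere_trichotomy[OF sphere[OF vertices(1)] _ _ _ not_dominant(1,2)]
        sphere_trichotomy[OF sphere[OF vertices(2)] _ _ _ not_dominant(3,4)]
      show False
        by (rule balanced_not_adjacent[OF _ two_unit _
              sphere[OF vertices(1)] sphere[OF vertices(2)] edge[OF adjacent]])
          (simp_all add: balanced units vertices lengths adjacent)
    qed
    show "\<not> high p" "\<not> high q" using integral by (simp_all add: not_high)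
    show "high s" using dominant by (simp add: high_def)
  qed (fact path)+
qed

lemma zero_or_unit_fun:
  fixes f :: "'i \<Rightarrow> 'k::field"
  assumes "\<And>m n. f m = 0 \<longleftrightarrow> f n = 0"
  shows "zero_or_unit f"
proof (cases "\<exists>n. f n = 0")
  case True
  then have "f = 0" using assms by (auto simp: fun_eq_iff)
  then show ?thesis by (simp add: zero_or_unit_def)
next
  case False
  then have "1 = f * (\<lambda>n. inverse (f n))" by (auto simp: fun_eq_iff)
  then show ?thesis unfolding zero_or_unit_def by (metis dvdI)
qed

lemma valuation_pair_of_infinite_range:
  fixes t :: "'i \<Rightarrow> 'k::field"
  assumes "infinite (range t)"
  obtains A M where "valuation_pair A M" "t \<in> M" "\<And>c. (\<lambda>_. c) \<in> A" "\<And>c. c \<noteq> 0 \<Longrightarrow> unit_in A (\<lambda>_. c)"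
proof -
  define A where "A = range (\<lambda>p n. poly p (t n))"
  have const: "(\<lambda>_. c) \<in> A" for c unfolding A_def by (rule range_eqI[of _ _ "[:c:]"]) simp
  interpret subring A
  proof
    show "1 \<in> A" using const[of 1] by (simp add: one_fun_def)
    fix x y assume "x \<in> A" "y \<in> A"
    then obtain p q where evaluations: "x = (\<lambda>n. poly p (t n))" "y = (\<lambda>n. poly q (t n))"
      by (auto simp: A_def)
    show "x - y \<in> A" unfolding A_def evaluations by (rule range_eqI[of _ _ "p - q"]) auto
    show "x * y \<in> A" unfolding A_def evaluations by (rule range_eqI[of _ _ "p * q"]) auto
  qed
  have "t \<in> A" unfolding A_def by (rule range_eqI[of _ _ "[:0, 1:]"]) simp
  moreover have "\<not> unit_in A t"
  proof
    assume "unit_in A t"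
    then obtain p where inverse: "t * (\<lambda>n. poly p (t n)) = 1" by (auto simp: unit_in_def A_def)
    have "t n * poly p (t n) = 1" for n using fun_cong[OF inverse, of n] by simp
    then have "range t \<subseteq> {x. poly (pCons (- 1) p) x = 0}" by auto
    moreover have "pCons (- 1) p \<noteq> 0" by simp
    ultimately show False using assms poly_roots_finite finite_subset by blast
  qed
  ultimately obtain B M where extension: "valuation_pair B M" "A \<subseteq> B" "t \<in> M"
    by (rule valuation_pair_exists)
  show thesis
  proof (rule that[OF extension(1,3)])
    show const_extension: "(\<lambda>_. c) \<in> B" for c using const extension(2) by blast
    show "unit_in B (\<lambda>_. c)" if "c \<noteq> 0" for c
      unfolding unit_in_def using that const_extension[of "1 / c"]
      by (intro bexI[of _ "\<lambda>_. 1 / c"]) (auto simp: fun_eq_iff)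
  qed
qed

subsection \<open>The group of rotations\<close>

lemma bilin_expand: "bilin T U = T $ 1 * U $ 1 + T $ 2 * U $ 2 + T $ 3 * U $ 3"
  by (simp add: bilin_def sum_3)

lemma bilin_commute: "bilin T U = bilin U T"
  by (simp add: bilin_def mult.commute)

lemma bilin_axis: "bilin T (axis i 1) = T $ i"
  by (simp add: bilin_def axis_def if_distrib cong: if_cong)

lemma sphere2C_iff: "T \<in> sphere2C \<longleftrightarrow> bilin T T = 1"
  by (simp add: sphere2C_def bilin_expand power2_eq_square)

lemma axis_in_sphere2C: "axis i 1 \<in> sphere2C"
  by (simp add: sphere2C_iff bilin_axis)

lemma bilin_transpose: "bilin (\<sigma> *v T) U = bilin T (transpose \<sigma> *v U)"
  by (simp add: bilin_expand matrix_vector_mult_def transpose_def sum_3 algebra_simps)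

lemma SO3C_transpose_cancel: "\<sigma> \<in> SO3C \<Longrightarrow> transpose \<sigma> *v (\<sigma> *v T) = T"
  by (simp add: SO3C_def matrix_vector_mul_assoc)

lemma SO3C_inj: "\<sigma> \<in> SO3C \<Longrightarrow> inj ((*v) \<sigma>)"
  using SO3C_transpose_cancel by (metis injI)

lemma SO3C_bilin: "\<sigma> \<in> SO3C \<Longrightarrow> bilin (\<sigma> *v T) (\<sigma> *v U) = bilin T U"
  by (simp add: bilin_transpose SO3C_transpose_cancel del: transpose_matrix_vector)

lemma SO3C_one: "mat 1 \<in> SO3C"
  by (simp add: SO3C_def transpose_mat)

lemma SO3C_transpose: "\<sigma> \<in> SO3C \<Longrightarrow> transpose \<sigma> \<in> SO3C"
  by (simp add: SO3C_def)

lemma SO3C_mult: "\<sigma> \<in> SO3C \<Longrightarrow> \<tau> \<in> SO3C \<Longrightarrow> \<sigma> ** \<tau> \<in> SO3C"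
  unfolding SO3C_def
  by (auto simp: matrix_transpose_mul det_mul) (metis matrix_mul_assoc matrix_mul_lid)+

definition cross_product :: "complex ^ 3 \<Rightarrow> complex ^ 3 \<Rightarrow> complex ^ 3" where
  "cross_product T U = vector
     [T $ 2 * U $ 3 - T $ 3 * U $ 2, T $ 3 * U $ 1 - T $ 1 * U $ 3, T $ 1 * U $ 2 - T $ 2 * U $ 1]"

lemma bilin_cross_product_self:
  "bilin (cross_product T U) (cross_product T U) = bilin T T * bilin U U - (bilin T U)\<^sup>2"
  by (simp add: bilin_expand cross_product_def) algebra

lemma bilin_cross_product_orthogonal:
  "bilin T (cross_product T U) = 0" "bilin U (cross_product T U) = 0"
  by (simp_all add: bilin_expand cross_product_def algebra_simps)

definition frame :: "complex ^ 3 \<Rightarrow> complex ^ 3 \<Rightarrow> complex ^ 3 ^ 3" where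
  "frame T U = vector [T, U, cross_product T U]"

lemma frame_rows: "frame T U $ 1 = T" "frame T U $ 2 = U" "frame T U $ 3 = cross_product T U"
  by (simp_all add: frame_def)

lemma frame_gram:
  "frame T U ** transpose (frame T U) = vector [vector [bilin T T, bilin T U, 0],
     vector [bilin T U, bilin U U, 0], vector [0, 0, bilin T T * bilin U U - (bilin T U)\<^sup>2]]"
proof -
  have "(C ** transpose C) $ i $ j = bilin (C $ i) (C $ j)" for C :: "complex ^ 3 ^ 3" and i j
    by (simp add: matrix_matrix_mult_def transpose_def bilin_def)
  then show ?thesis
    by (simp add: vec_eq_iff forall_3 frame_rows bilin_cross_product_self bilin_cross_product_orthogonal
        bilin_commute[of U T] bilin_commute[of "cross_product T U"])
qed

lemma det_frame: "det (frame T U) = bilin T T * bilin U U - (bilin T U)\<^sup>2"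
  unfolding bilin_cross_product_self[symmetric]
  by (simp add: frame_def det_3 bilin_expand cross_product_def algebra_simps)

lemma SO3C_of_equal_gram:
  fixes C D :: "complex ^ 3 ^ 3"
  assumes gram: "D ** transpose D = C ** transpose C" and det: "det D = det C" "det C \<noteq> 0"
  obtains \<sigma> where "\<sigma> \<in> SO3C" "\<And>i. \<sigma> *v (C $ i) = D $ i"
proof -
  have "invertible C" using det(2) by (simp add: invertible_det_nz)
  then obtain B where inverse: "C ** B = mat 1" "B ** C = mat 1" by (auto simp: invertible_def)
  define \<sigma> where "\<sigma> = transpose (B ** D)"
  have "transpose \<sigma> ** \<sigma> = B ** (D ** transpose D) ** transpose B"
    by (simp add: \<sigma>_def matrix_transpose_mul matrix_mul_assoc)
  also have "\<dots> = (B ** C) ** transpose (B ** C)"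
    by (simp add: gram matrix_mul_assoc matrix_transpose_mul)
  finally have "transpose \<sigma> ** \<sigma> = mat 1" by (simp add: inverse(2))
  moreover from this have "\<sigma> ** transpose \<sigma> = mat 1" using matrix_left_right_inverse by blast
  moreover have "det \<sigma> = 1"
    using arg_cong[OF inverse(1), of det] by (simp add: \<sigma>_def det_mul det(1) mult.commute)
  ultimately have "\<sigma> \<in> SO3C" by (simp add: SO3C_def)
  moreover have "C ** transpose \<sigma> = D" by (simp add: \<sigma>_def matrix_mul_assoc inverse(1))
  then have "\<sigma> *v (C $ i) = D $ i" for i
    by (auto simp: vec_eq_iff matrix_matrix_mult_def matrix_vector_mult_def transpose_def mult.commute)
  ultimately show thesis by (rule that)
qed

lemma SO3C_transitive_on_pairs:
  assumes "T \<in> sphere2C" "U \<in> sphere2C" "T' \<in> sphere2C" "U' \<in> sphere2C"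
    and "bilin T U = bilin T' U'" "(bilin T U)\<^sup>2 \<noteq> 1"
  obtains \<sigma> where "\<sigma> \<in> SO3C" "\<sigma> *v T = T'" "\<sigma> *v U = U'"
proof -
  obtain \<sigma> where "\<sigma> \<in> SO3C" "\<And>i. \<sigma> *v (frame T U $ i) = frame T' U' $ i"
    using SO3C_of_equal_gram[of "frame T' U'" "frame T U"] assms
    by (auto simp: frame_gram det_frame sphere2C_iff)
  then show thesis using that by (metis frame_rows)
qed

lemma SO3C_moves_to:
  assumes "T \<in> sphere2C" "U \<in> sphere2C" "(bilin T U)\<^sup>2 \<noteq> 1"
  obtains \<sigma> where "\<sigma> \<in> SO3C" "\<sigma> *v T = U"
  using SO3C_transitive_on_pairs[of T U U T] assms by (auto simp: bilin_commute)

lemma SO3C_moves_to_axis: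
  assumes "T \<in> sphere2C"
  obtains \<sigma> where "\<sigma> \<in> SO3C" "\<sigma> *v T = axis k 1"
proof -
  have "(T $ 1)\<^sup>2 + (T $ 2)\<^sup>2 + (T $ 3)\<^sup>2 = 1" using assms by (simp add: sphere2C_def)
  then obtain i where "(T $ i)\<^sup>2 \<noteq> 1" by fastforce
  then obtain \<sigma> where to_axis: "\<sigma> \<in> SO3C" "\<sigma> *v T = axis i 1"
    using SO3C_moves_to[OF assms axis_in_sphere2C[of i]] by (auto simp: bilin_axis)
  show thesis
  proof (cases "i = k")
    case True
    then show ?thesis using to_axis that by blast
  next
    case False
    then have "(bilin (axis i 1) (axis k 1))\<^sup>2 \<noteq> 1" by (simp add: bilin_axis) (simp add: axis_def)
    then obtain \<tau> where "\<tau> \<in> SO3C" "\<tau> *v axis i 1 = axis k 1"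
      using SO3C_moves_to axis_in_sphere2C by metis
    then show ?thesis
      using to_axis that[of "\<tau> ** \<sigma>"] SO3C_mult by (simp flip: matrix_vector_mul_assoc)
  qed
qed

lemma SO3C_transitive:
  assumes "T \<in> sphere2C" "U \<in> sphere2C"
  obtains \<sigma> where "\<sigma> \<in> SO3C" "\<sigma> *v T = U"
proof -
  obtain \<sigma> \<tau> where "\<sigma> \<in> SO3C" "\<sigma> *v T = axis 3 1" "\<tau> \<in> SO3C" "\<tau> *v U = axis 3 1"
    using SO3C_moves_to_axis assms by metis
  then show thesis
    using that[of "transpose \<tau> ** \<sigma>"] SO3C_mult SO3C_transpose SO3C_transpose_cancel
    by (metis matrix_vector_mul_assoc)
qed

subsection \<open>Realizations of graphs\<close>

lemma simple_graph_edgeD: "simple_graph V E \<Longrightarrow> {a, b} \<in> E \<Longrightarrow> a \<in> V \<and> b \<in> V \<and> a \<noteq> b"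
  unfolding simple_graph_def by (force simp: doubleton_eq_iff)

lemma simple_graph_edgeE:
  assumes "simple_graph V E" "e \<in> E"
  obtains a b where "e = {a, b}"
  using assms by (auto simp: simple_graph_def)

lemma assignment_iff: "assignment E lam \<longleftrightarrow> (\<forall>e\<in>E. (1 - 2 * lam e)\<^sup>2 \<noteq> 1)"
  by (auto simp: assignment_def power2_eq_1_iff)

lemma compatible_iff:
  "compatible E lam \<rho> \<longleftrightarrow> (\<forall>a b. {a, b} \<in> E \<longrightarrow> bilin (\<rho> a) (\<rho> b) = 1 - 2 * lam {a, b})"
  by (auto simp: compatible_def sph_dist_def field_simps)

lemma compatible_cong:
  assumes "simple_graph V E" "\<And>x. x \<in> V \<Longrightarrow> \<rho> x = \<rho>' x"
  shows "compatible E lam \<rho> = compatible E lam \<rho>'"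
  using simple_graph_edgeD[OF assms(1)] assms(2) by (auto simp: compatible_def)

lemma SO3C_realization: "\<sigma> \<in> SO3C \<Longrightarrow> realization V \<rho> \<Longrightarrow> realization V (\<lambda>x. \<sigma> *v \<rho> x)"
  by (simp add: realization_def sphere2C_iff SO3C_bilin)

lemma SO3C_compatible: "\<sigma> \<in> SO3C \<Longrightarrow> compatible E lam \<rho> \<Longrightarrow> compatible E lam (\<lambda>x. \<sigma> *v \<rho> x)"
  by (simp add: compatible_iff SO3C_bilin)

lemma SO3C_restrict_realization:
  assumes "simple_graph V E" "\<sigma> \<in> SO3C" "realization V \<rho>" "compatible E lam \<rho>"
  shows "realization V (\<lambda>x\<in>V. \<sigma> *v \<rho> x)" "compatible E lam (\<lambda>x\<in>V. \<sigma> *v \<rho> x)"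
proof -
  have "realization V (\<lambda>x. \<sigma> *v \<rho> x)" "compatible E lam (\<lambda>x. \<sigma> *v \<rho> x)"
    using assms(2-4) by (simp_all add: SO3C_realization SO3C_compatible)
  then show "realization V (\<lambda>x\<in>V. \<sigma> *v \<rho> x)" "compatible E lam (\<lambda>x\<in>V. \<sigma> *v \<rho> x)"
    using compatible_cong[OF assms(1), of "\<lambda>x\<in>V. \<sigma> *v \<rho> x" "\<lambda>x. \<sigma> *v \<rho> x"]
    by (simp_all add: realization_def)
qed

lemma essentially_distinctI:
  assumes "r \<in> V" "s \<in> V" "bilin (\<rho>\<^sub>1 r) (\<rho>\<^sub>1 s) \<noteq> bilin (\<rho>\<^sub>2 r) (\<rho>\<^sub>2 s)"
  shows "essentially_distinct V \<rho>\<^sub>1 \<rho>\<^sub>2"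
  using assms SO3C_bilin unfolding essentially_distinct_def by metis

lemma essentially_distinct_imp_edge:
  assumes connected: "connected_graph V E" and distinct: "essentially_distinct V \<rho>\<^sub>1 \<rho>\<^sub>2"
    and realizations: "realization V \<rho>\<^sub>1" "realization V \<rho>\<^sub>2"
  shows "E \<noteq> {}"
proof
  assume "E = {}"
  then have singleton: "x = y" if "x \<in> V" "y \<in> V" for x y
    using connected that by (simp add: connected_graph_def)
  obtain v where "v \<in> V" using distinct SO3C_one by (auto simp: essentially_distinct_def)
  then obtain \<sigma> where "\<sigma> \<in> SO3C" "\<sigma> *v \<rho>\<^sub>2 v = \<rho>\<^sub>1 v"
    using realizations SO3C_transitive unfolding realization_def by metis
  then show False
    using distinct singleton[OF \<open>v \<in> V\<close>] unfolding essentially_distinct_def by metis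
qed

lemma flexible_assignment_imp_edge:
  assumes "connected_graph V E" "flexible_assignment V E lam"
  shows "E \<noteq> {}"
proof -
  obtain R where "infinite R" "pairwise (essentially_distinct V) R" "\<And>\<rho>. \<rho> \<in> R \<Longrightarrow> realization V \<rho>"
    using assms(2) unfolding flexible_assignment_def by blast
  moreover from \<open>infinite R\<close> obtain \<rho>\<^sub>1 \<rho>\<^sub>2 where "\<rho>\<^sub>1 \<in> R" "\<rho>\<^sub>2 \<in> R" "\<rho>\<^sub>1 \<noteq> \<rho>\<^sub>2"
    by (metis finite.emptyI finite_insert finite_subset insertI1 subsetI)
  ultimately show ?thesis
    using essentially_distinct_imp_edge[OF assms(1), of \<rho>\<^sub>1 \<rho>\<^sub>2] by (auto simp: pairwise_def)
qed

lemma inj_on_rotate_essentially_distinct: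
  assumes "pairwise (essentially_distinct V) R" "\<And>\<rho>. \<rho> \<in> R \<Longrightarrow> S \<rho> \<in> SO3C"
  shows "inj_on (\<lambda>\<rho>. \<lambda>x\<in>V. S \<rho> *v \<rho> x) R"
proof (rule inj_onI, rule ccontr)
  fix \<rho>\<^sub>1 \<rho>\<^sub>2
  assume different: "\<rho>\<^sub>1 \<in> R" "\<rho>\<^sub>2 \<in> R" "\<rho>\<^sub>1 \<noteq> \<rho>\<^sub>2"
    and equal: "(\<lambda>x\<in>V. S \<rho>\<^sub>1 *v \<rho>\<^sub>1 x) = (\<lambda>x\<in>V. S \<rho>\<^sub>2 *v \<rho>\<^sub>2 x)"
  let ?\<tau> = "transpose (S \<rho>\<^sub>1) ** S \<rho>\<^sub>2"
  have "\<rho>\<^sub>1 x = ?\<tau> *v \<rho>\<^sub>2 x" if "x \<in> V" for x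
  proof -
    have "S \<rho>\<^sub>1 *v \<rho>\<^sub>1 x = S \<rho>\<^sub>2 *v \<rho>\<^sub>2 x" using fun_cong[OF equal, of x] that by simp
    then show ?thesis
      using SO3C_transpose_cancel[OF assms(2)[OF different(1)]] by (metis matrix_vector_mul_assoc)
  qed
  moreover have "?\<tau> \<in> SO3C" using assms(2) different by (simp add: SO3C_mult SO3C_transpose)
  ultimately show False
    using assms(1) different unfolding pairwise_def essentially_distinct_def by blast
qed

subsection \<open>Flexible assignments from NAP-colorings\<close>

definition sph_point :: "real \<Rightarrow> real \<Rightarrow> complex ^ 3" where
  "sph_point a \<theta> = vector [of_real (sin a * cos \<theta>), of_real (sin a * sin \<theta>), of_real (cos a)]"

lemma bilin_sph_point:
  "bilin (sph_point a \<theta>) (sph_point b \<phi>) = of_real (sin a * sin b * cos (\<theta> - \<phi>) + cos a * cos b)"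
  by (simp add: bilin_expand sph_point_def cos_diff algebra_simps)

lemma sph_point_in_sphere2C: "sph_point a \<theta> \<in> sphere2C"
  using sin_cos_squared_add[of a] by (simp add: sphere2C_iff bilin_sph_point power2_eq_square)

lemma cos_squared_neq_one:
  fixes x :: real
  assumes "x \<noteq> 0" "\<bar>x\<bar> < pi"
  shows "(cos x)\<^sup>2 \<noteq> 1"
proof -
  have "0 < sin \<bar>x\<bar>" using assms by (intro sin_gt_zero) auto
  then have "0 < (sin x)\<^sup>2" by (auto simp: abs_if split: if_splits)
  then show ?thesis using sin_cos_squared_add[of x] by linarith
qed

lemma doubleton_function_exists:
  assumes "\<And>a b. f a b = f b a"
  obtains g where "\<And>a b. g {a, b} = f a b"
proof
  fix a b
  show "(SOME y. \<exists>c d. {a, b} = {c, d} \<and> y = f c d) = f a b"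
    by (rule some_equality) (use assms in \<open>auto simp: doubleton_eq_iff\<close>)
qed

definition partially_rotated :: "('v \<Rightarrow> real) \<Rightarrow> ('v \<Rightarrow> bool) \<Rightarrow> real \<Rightarrow> 'v \<Rightarrow> complex ^ 3" where
  "partially_rotated \<alpha> P \<theta> v = sph_point (\<alpha> v) (if P v then \<theta> else 0)"

lemma bilin_partially_rotated:
  assumes "\<alpha> a = 0 \<or> \<alpha> b = 0 \<or> P a = P b"
  shows "bilin (partially_rotated \<alpha> P \<theta> a) (partially_rotated \<alpha> P \<theta> b) = of_real (cos (\<alpha> a - \<alpha> b))"
  using assms by (auto simp: partially_rotated_def bilin_sph_point cos_diff[of "\<alpha> a" "\<alpha> b"])

lemma partially_rotated_inj:
  assumes "P r" "\<not> P s" "\<alpha> r \<in> {0<..1}" "\<alpha> s \<in> {0<..1}" and angles: "\<theta> \<in> {0..1}" "\<phi> \<in> {0..1}"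
    and same_product: "bilin (partially_rotated \<alpha> P \<theta> r) (partially_rotated \<alpha> P \<theta> s)
      = bilin (partially_rotated \<alpha> P \<phi> r) (partially_rotated \<alpha> P \<phi> s)"
  shows "\<theta> = \<phi>"
proof -
  have "0 < sin (\<alpha> r)" "0 < sin (\<alpha> s)" using assms(3,4) pi_gt3 by (auto intro!: sin_gt_zero)
  moreover have "sin (\<alpha> r) * sin (\<alpha> s) * cos \<theta> = sin (\<alpha> r) * sin (\<alpha> s) * cos \<phi>"
    using same_product assms(1,2)
    by (simp add: partially_rotated_def bilin_sph_point of_real_eq_iff flip: of_real_mult of_real_add)
  ultimately have "cos \<theta> = cos \<phi>" by simp
  then show ?thesis using cos_inj_pi[of \<theta> \<phi>] angles pi_gt3 by simp
qed

lemma flexible_assignment_by_rotation: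
  fixes \<alpha> :: "'v \<Rightarrow> real"
  assumes graph: "simple_graph V E"
    and bounds: "\<And>v. \<alpha> v \<in> {0..1}" and separated: "\<And>a b. {a, b} \<in> E \<Longrightarrow> \<alpha> a \<noteq> \<alpha> b"
    and rigid: "\<And>a b. {a, b} \<in> E \<Longrightarrow> \<alpha> a = 0 \<or> \<alpha> b = 0 \<or> P a = P b"
    and rotating: "r \<in> V" "P r" "0 < \<alpha> r" and resting: "s \<in> V" "\<not> P s" "0 < \<alpha> s"
  shows "\<exists>lam. flexible_assignment V E lam"
proof -
  let ?\<rho> = "partially_rotated \<alpha> P"
  have "cos (\<alpha> a - \<alpha> b) = cos (\<alpha> b - \<alpha> a)" for a b by (metis cos_minus minus_diff_eq)
  then obtain lam where lengths: "\<And>a b. lam {a, b} = (1 - complex_of_real (cos (\<alpha> a - \<alpha> b))) / 2"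
    using doubleton_function_exists[of "\<lambda>a b. (1 - complex_of_real (cos (\<alpha> a - \<alpha> b))) / 2"] by metis
  have "assignment E lam"
    unfolding assignment_iff
  proof
    fix e assume "e \<in> E"
    then obtain a b where edge: "e = {a, b}" using graph by (metis simple_graph_edgeE)
    then have "\<alpha> a - \<alpha> b \<noteq> 0" using separated \<open>e \<in> E\<close> by simp
    moreover have "\<bar>\<alpha> a - \<alpha> b\<bar> < pi" using bounds[of a] bounds[of b] pi_gt3 by auto
    ultimately have "(cos (\<alpha> a - \<alpha> b))\<^sup>2 \<noteq> 1" by (rule cos_squared_neq_one)
    moreover have "1 - 2 * lam e = of_real (cos (\<alpha> a - \<alpha> b))"
      by (simp add: edge lengths diff_divide_distrib)
    ultimately show "(1 - 2 * lam e)\<^sup>2 \<noteq> 1" by (simp flip: of_real_power)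
  qed
  moreover have "realization V (?\<rho> \<theta>)" for \<theta>
    by (simp add: realization_def partially_rotated_def sph_point_in_sphere2C)
  moreover have "compatible E lam (?\<rho> \<theta>)" for \<theta>
    by (simp add: compatible_iff lengths rigid bilin_partially_rotated diff_divide_distrib)
  moreover have distinct: "\<theta> = \<phi>" if "\<theta> \<in> {0..1}" "\<phi> \<in> {0..1}"
    "bilin (?\<rho> \<theta> r) (?\<rho> \<theta> s) = bilin (?\<rho> \<phi> r) (?\<rho> \<phi> s)" for \<theta> \<phi>
    using partially_rotated_inj[of P r s \<alpha>] that rotating resting bounds[of r] bounds[of s] by auto
  then have "inj_on ?\<rho> {0..1}" by (intro inj_onI) auto
  then have "infinite (?\<rho> ` {0..1})" by (simp add: finite_image_iff infinite_Icc)
  moreover have "pairwise (essentially_distinct V) (?\<rho> ` {0..1})"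
    using distinct essentially_distinctI[OF rotating(1) resting(1)] unfolding pairwise_def by blast
  ultimately show ?thesis unfolding flexible_assignment_def by blast
qed

definition meets_color :: "'v set set \<Rightarrow> ('v set \<Rightarrow> color) \<Rightarrow> color \<Rightarrow> 'v \<Rightarrow> bool" where
  "meets_color E \<epsilon> k v \<longleftrightarrow> (\<exists>x. {v, x} \<in> E \<and> \<epsilon> {v, x} = k)"

definition bicolored :: "'v set set \<Rightarrow> ('v set \<Rightarrow> color) \<Rightarrow> 'v \<Rightarrow> bool" where
  "bicolored E \<epsilon> v \<longleftrightarrow> (\<forall>k. meets_color E \<epsilon> k v)"

lemma edge_meets_color:
  assumes "{a, b} \<in> E"
  shows "meets_color E \<epsilon> (\<epsilon> {a, b}) a" "meets_color E \<epsilon> (\<epsilon> {a, b}) b"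
  using assms by (auto simp: meets_color_def insert_commute)

lemma bicolored_not_adjacent:
  assumes "NAP_coloring E \<epsilon>" "{a, b} \<in> E"
  shows "\<not> (bicolored E \<epsilon> a \<and> bicolored E \<epsilon> b)"
proof
  assume bicolored: "bicolored E \<epsilon> a \<and> bicolored E \<epsilon> b"
  obtain k where "k \<noteq> \<epsilon> {a, b}" by (metis color.distinct(1))
  moreover obtain x y where "{a, x} \<in> E" "\<epsilon> {a, x} = k" "{b, y} \<in> E" "\<epsilon> {b, y} = k"
    using bicolored unfolding bicolored_def meets_color_def by blast
  ultimately have "alternating_path E \<epsilon> x a b y"
    using assms(2) by (auto simp: alternating_path_def insert_commute)
  then show False using assms(1) by (auto simp: NAP_coloring_def)
qed

lemma not_bicolored_iff:
  "\<not> bicolored E \<epsilon> v \<Longrightarrow> meets_color E \<epsilon> k v \<Longrightarrow> meets_color E \<epsilon> k' v \<longleftrightarrow> k' = k"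
  unfolding bicolored_def by (metis color.exhaust)

lemma monochromatic_vertex_exists:
  assumes "simple_graph V E" "NAP_coloring E \<epsilon>"
  obtains v where "v \<in> V" "meets_color E \<epsilon> k v" "\<not> bicolored E \<epsilon> v"
proof -
  obtain e where "e \<in> E" "\<epsilon> e = k"
    using assms(2) by (auto simp: NAP_coloring_def) (metis UNIV_I imageE)
  then obtain a b where "{a, b} \<in> E" "\<epsilon> {a, b} = k" using assms(1) by (metis simple_graph_edgeE)
  then show thesis
    using that edge_meets_color bicolored_not_adjacent[OF assms(2)] simple_graph_edgeD[OF assms(1)]
    by metis
qed

lemma separating_colatitudes_exist:
  assumes graph: "simple_graph V E" and independent: "\<And>a b. {a, b} \<in> E \<Longrightarrow> \<not> (N a \<and> N b)"
  obtains \<alpha> :: "'v \<Rightarrow> real" where "\<And>v. \<alpha> v \<in> {0..1}" "\<And>v. \<alpha> v = 0 \<longleftrightarrow> N v"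
    "\<And>a b. {a, b} \<in> E \<Longrightarrow> \<alpha> a \<noteq> \<alpha> b"
proof -
  have "finite V" using graph by (simp add: simple_graph_def)
  then obtain f :: "'v \<Rightarrow> nat" where injective: "inj_on f V" using finite_imp_inj_to_nat_seg by blast
  define \<alpha> where "\<alpha> v = (if N v then 0 else 1 / (1 + real (f v)))" for v
  show thesis
  proof
    show "\<alpha> v \<in> {0..1}" "\<alpha> v = 0 \<longleftrightarrow> N v" for v by (auto simp: \<alpha>_def field_simps)
    show "\<alpha> a \<noteq> \<alpha> b" if "{a, b} \<in> E" for a b
      using independent[OF that] simple_graph_edgeD[OF graph that] injective
      by (auto simp: \<alpha>_def inj_on_def add_eq_0_iff)
  qed
qed

text \<open>Bicolored vertices are never adjacent, so they can all be put at the north pole. The other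
  vertices meeting a red edge rotate about the axis, and the rest stays fixed.\<close>

lemma NAP_coloring_imp_flexible:
  fixes V :: "'v set"
  assumes graph: "simple_graph V E" and coloring: "NAP_coloring E \<epsilon>"
  shows "\<exists>lam. flexible_assignment V E lam"
proof -
  have "\<not> (bicolored E \<epsilon> a \<and> bicolored E \<epsilon> b)" if "{a, b} \<in> E" for a b
    using coloring that by (rule bicolored_not_adjacent)
  then obtain \<alpha> :: "'v \<Rightarrow> real"
    where colatitude: "\<And>v. \<alpha> v \<in> {0..1}" "\<And>v. \<alpha> v = 0 \<longleftrightarrow> bicolored E \<epsilon> v"
    and separated: "\<And>a b. {a, b} \<in> E \<Longrightarrow> \<alpha> a \<noteq> \<alpha> b"
    by (rule separating_colatitudes_exist[of V E "bicolored E \<epsilon>", OF graph]) blast+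
  obtain r where rotating: "r \<in> V" "meets_color E \<epsilon> Red r" "\<not> bicolored E \<epsilon> r"
    using monochromatic_vertex_exists[OF graph coloring] .
  obtain s where resting: "s \<in> V" "meets_color E \<epsilon> Blue s" "\<not> bicolored E \<epsilon> s"
    using monochromatic_vertex_exists[OF graph coloring] .
  have positive: "0 < \<alpha> v" if "\<not> bicolored E \<epsilon> v" for v
    using colatitude(1)[of v] colatitude(2)[of v] that by simp
  show ?thesis
  proof (rule flexible_assignment_by_rotation[OF graph colatitude(1) separated])
    show "\<alpha> a = 0 \<or> \<alpha> b = 0 \<or> meets_color E \<epsilon> Red a = meets_color E \<epsilon> Red b" if "{a, b} \<in> E" for a b
      using edge_meets_color[OF that] not_bicolored_iff unfolding colatitude(2) by metis
    show "\<not> meets_color E \<epsilon> Red s" using not_bicolored_iff[OF resting(3,2)] by simp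
  qed (use rotating resting positive in auto)
qed

subsection \<open>NAP-colorings from flexible assignments\<close>

definition iso_u :: "complex ^ 3 \<Rightarrow> complex" where "iso_u T = T $ 1 + \<i> * T $ 2"
definition iso_w :: "complex ^ 3 \<Rightarrow> complex" where "iso_w T = T $ 1 - \<i> * T $ 2"

lemma bilin_iso: "2 * bilin T U = 2 * (T $ 3 * U $ 3) + iso_u T * iso_w U + iso_w T * iso_u U"
  by (simp add: bilin_expand iso_u_def iso_w_def algebra_simps)

lemma sphere2C_iso: "T \<in> sphere2C \<longleftrightarrow> iso_u T * iso_w T + T $ 3 * T $ 3 = 1"
  by (simp add: sphere2C_iff bilin_expand iso_u_def iso_w_def algebra_simps)

lemma iso_eqI:
  assumes "iso_u T = iso_u U" "iso_w T = iso_w U" "T $ 3 = U $ 3"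
  shows "T = U"
proof -
  have "X $ 1 = (iso_u X + iso_w X) / 2" "X $ 2 = (iso_u X - iso_w X) / (2 * \<i>)" for X
    by (simp_all add: iso_u_def iso_w_def)
  then have "T $ 1 = U $ 1" "T $ 2 = U $ 2" using assms(1,2) by metis+
  then show ?thesis using assms(3) by (simp add: vec_eq_iff forall_3)
qed

lemma inj_on_iso_u:
  assumes "c\<^sup>2 \<noteq> 1"
  shows "inj_on iso_u {T \<in> sphere2C. T $ 3 = c}"
proof (rule inj_onI)
  fix T U assume parallel: "T \<in> {T \<in> sphere2C. T $ 3 = c}" "U \<in> {T \<in> sphere2C. T $ 3 = c}"
    and equal: "iso_u T = iso_u U"
  have product: "iso_u X * iso_w X = 1 - c\<^sup>2" if "X \<in> {T \<in> sphere2C. T $ 3 = c}" for X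
    using that by (auto simp: sphere2C_iso power2_eq_square algebra_simps)
  have "iso_u T * iso_w T = iso_u T * iso_w U"
    using product[OF parallel(1)] product[OF parallel(2)] equal by simp
  moreover have "iso_u T \<noteq> 0" using product[OF parallel(1)] assms by auto
  ultimately have "iso_w T = iso_w U" by simp
  then show "T = U" using equal parallel by (auto intro: iso_eqI)
qed

lemma degenerating_sequence_NAP_coloring:
  fixes \<rho> :: "nat \<Rightarrow> 'v \<Rightarrow> complex ^ 3"
  assumes graph: "simple_graph V E" and assignment: "assignment E lam"
    and realization: "\<And>n. realization V (\<rho> n)" and compatible: "\<And>n. compatible E lam (\<rho> n)"
    and path: "{p, q} \<in> E" "{q, s} \<in> E"
    and fixed: "\<And>n. \<rho> n p = T" "\<And>n. \<rho> n q = axis 3 1"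
    and moving: "infinite (range (\<lambda>n. iso_u (\<rho> n s)))"
    and zeros: "\<And>x m n. x \<in> V \<Longrightarrow> iso_u (\<rho> m x) = 0 \<longleftrightarrow> iso_u (\<rho> n x) = 0"
      "\<And>x m n. x \<in> V \<Longrightarrow> iso_w (\<rho> m x) = 0 \<longleftrightarrow> iso_w (\<rho> n x) = 0"
      "\<And>x m n. x \<in> V \<Longrightarrow> \<rho> m x $ 3 = 0 \<longleftrightarrow> \<rho> n x $ 3 = 0"
  shows "\<exists>\<epsilon>. NAP_coloring E \<epsilon>"
proof -
  define u w z where "u x = (\<lambda>n. iso_u (\<rho> n x))" and "w x = (\<lambda>n. iso_w (\<rho> n x))"
    and "z x = (\<lambda>n. \<rho> n x $ 3)" for x
  define c :: "'v set \<Rightarrow> nat \<Rightarrow> complex" where "c e = (\<lambda>_. 1 - 2 * lam e)" for e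
  obtain A M where "valuation_pair A M" "u s \<in> M" and const: "\<And>k. (\<lambda>_. k) \<in> A"
    and unit_const: "\<And>k. k \<noteq> 0 \<Longrightarrow> unit_in A (\<lambda>_. k)"
    using valuation_pair_of_infinite_range[OF moving] unfolding u_def by metis
  then interpret valuation_pair A M by simp
  have sphere: "u x * w x + z x * z x = 1" if "x \<in> V" for x
    using realization that by (auto simp: fun_eq_iff u_def w_def z_def realization_def sphere2C_iso)
  have cosine: "bilin (\<rho> n a) (\<rho> n b) = 1 - 2 * lam {a, b}" if "{a, b} \<in> E" for n a b
    using compatible[of n] that by (simp add: compatible_iff)
  have edge: "2 * c {a, b} = 2 * (z a * z b) + u a * w b + w a * u b" if "{a, b} \<in> E" for a b
  proof
    fix n show "(2 * c {a, b}) n = (2 * (z a * z b) + u a * w b + w a * u b) n"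
      using bilin_iso[of "\<rho> n a" "\<rho> n b"] cosine[OF that, of n]
      by (simp add: u_def w_def z_def c_def numeral_fun)
  qed
  have lengths: "c e \<in> A \<and> unit_in A (c e * c e - 1)" if "e \<in> E" for e
  proof -
    have "(1 - 2 * lam e) * (1 - 2 * lam e) - 1 \<noteq> 0"
      using assignment that by (simp add: assignment_iff power2_eq_square)
    moreover have "c e * c e - 1 = (\<lambda>_. (1 - 2 * lam e) * (1 - 2 * lam e) - 1)"
      by (simp add: c_def fun_eq_iff)
    ultimately show ?thesis using unit_const const by (simp add: c_def)
  qed
  show ?thesis
  proof (rule NAP_coloring_from_valued_realization[where c = c, OF _ sphere _ edge lengths _ path])
    show "a \<in> V \<and> b \<in> V" if "{a, b} \<in> E" for a b using simple_graph_edgeD[OF graph that] by blast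
    show "zero_or_unit (u x) \<and> zero_or_unit (w x) \<and> zero_or_unit (z x)" if "x \<in> V" for x
      unfolding u_def w_def z_def by (intro conjI zero_or_unit_fun zeros that)
    show "unit_in A 2" using unit_const[of 2] by (simp add: numeral_fun)
    show "w p \<in> A" "w q \<in> A" using const by (simp_all add: w_def fixed)
    have "z s = c {q, s}"
      using cosine[OF path(2)]
      by (simp add: z_def c_def fixed bilin_axis bilin_commute[of "axis 3 1"] fun_eq_iff)
    then show "dominant M (w s) (z s)"
      using dominant_of_small_conjugate[OF sphere \<open>u s \<in> M\<close>] lengths[OF path(2)]
        simple_graph_edgeD[OF graph path(2)] by simp
  qed
qed

lemma infinite_image_fiber:
  assumes "infinite (g ` Q)" "finite (\<kappa> ` Q)"
  obtains k where "infinite (g ` {x \<in> Q. \<kappa> x = k})"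
proof -
  have "g ` Q = (\<Union>k\<in>\<kappa> ` Q. g ` {x \<in> Q. \<kappa> x = k})" by blast
  then show thesis using assms that by (metis (no_types, lifting) finite_UN_I)
qed

lemma infinite_extensional_component:
  assumes "finite V" "Q \<subseteq> extensional V" "infinite Q"
  obtains s where "s \<in> V" "infinite ((\<lambda>\<rho>. \<rho> s) ` Q)"
proof -
  have "Q \<subseteq> PiE V (\<lambda>s. (\<lambda>\<rho>. \<rho> s) ` Q)" using assms(2) unfolding PiE_def Pi_def by blast
  then have "\<not> finite (PiE V (\<lambda>s. (\<lambda>\<rho>. \<rho> s) ` Q))" using assms(3) finite_subset by blast
  then show thesis using finite_PiE[OF assms(1), of "\<lambda>s. (\<lambda>\<rho>. \<rho> s) ` Q"] that by auto
qed

lemma connected_graph_exit_path: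
  assumes connected: "connected_graph V E" and edge: "{a, b} \<in> E" and inside: "P a" "P b"
    and outside: "a \<in> V" "t \<in> V" "\<not> P t"
  obtains p q s where "{p, q} \<in> E" "{q, s} \<in> E" "P p" "P q" "\<not> P s"
proof (rule ccontr)
  assume no_exit: "\<not> thesis"
  have "(a, t) \<in> {(x, y). {x, y} \<in> E}\<^sup>*" using connected outside by (simp add: connected_graph_def)
  then have "P t \<and> (\<exists>y. {y, t} \<in> E \<and> P y)"
  proof (induction rule: rtrancl_induct)
    case base
    show ?case using edge inside by (auto simp: insert_commute)
  next
    case (step x y)
    then show ?case using no_exit that by blast
  qed
  then show False using outside(3) by blast
qed

definition tilted_pole :: "complex \<Rightarrow> complex ^ 3" where
  "tilted_pole c = vector [csqrt (1 - c\<^sup>2), 0, c]"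

lemma SO3C_moves_edge_to_pole:
  assumes "T \<in> sphere2C" "U \<in> sphere2C" "bilin T U = c" "c\<^sup>2 \<noteq> 1"
  obtains \<sigma> where "\<sigma> \<in> SO3C" "\<sigma> *v T = axis 3 1" "\<sigma> *v U = tilted_pole c"
proof (rule SO3C_transitive_on_pairs[of T U "axis 3 1" "tilted_pole c"])
  show "tilted_pole c \<in> sphere2C" by (simp add: sphere2C_def tilted_pole_def)
  show "bilin T U = bilin (axis 3 1) (tilted_pole c)"
    using assms(3) bilin_commute bilin_axis by (metis tilted_pole_def vector_3(3))
qed (use assms axis_in_sphere2C that in auto)

lemma flexible_assignment_normalized:
  assumes graph: "simple_graph V E" and connected: "connected_graph V E"
    and flexible: "flexible_assignment V E lam"
  obtains a b T U Q where "{a, b} \<in> E" "infinite Q" "Q \<subseteq> extensional V"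
    "\<And>\<rho>. \<rho> \<in> Q \<Longrightarrow> realization V \<rho> \<and> compatible E lam \<rho> \<and> \<rho> a = T \<and> \<rho> b = U"
proof -
  obtain R where "infinite R" and distinct: "pairwise (essentially_distinct V) R"
    and compatible: "\<And>\<rho>. \<rho> \<in> R \<Longrightarrow> realization V \<rho> \<and> compatible E lam \<rho>"
    using flexible unfolding flexible_assignment_def by blast
  obtain a b where edge: "{a, b} \<in> E"
    using flexible_assignment_imp_edge[OF connected flexible] simple_graph_edgeE[OF graph]
    by (metis ex_in_conv)
  define c where "c = 1 - 2 * lam {a, b}"
  have "c\<^sup>2 \<noteq> 1" using flexible edge by (auto simp: flexible_assignment_def assignment_iff c_def)
  have vertices: "a \<in> V" "b \<in> V" using simple_graph_edgeD[OF graph edge] by auto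
  have "\<exists>\<sigma>\<in>SO3C. \<sigma> *v \<rho> a = axis 3 1 \<and> \<sigma> *v \<rho> b = tilted_pole c" if "\<rho> \<in> R" for \<rho>
  proof -
    have "\<rho> a \<in> sphere2C" "\<rho> b \<in> sphere2C" "bilin (\<rho> a) (\<rho> b) = c"
      using compatible[OF that] vertices edge by (auto simp: realization_def compatible_iff c_def)
    then show ?thesis using \<open>c\<^sup>2 \<noteq> 1\<close> SO3C_moves_edge_to_pole by metis
  qed
  then obtain S where rotation: "\<And>\<rho>. \<rho> \<in> R \<Longrightarrow> S \<rho> \<in> SO3C"
    and normal: "\<And>\<rho>. \<rho> \<in> R \<Longrightarrow> S \<rho> *v \<rho> a = axis 3 1" "\<And>\<rho>. \<rho> \<in> R \<Longrightarrow> S \<rho> *v \<rho> b = tilted_pole c"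
    by metis
  define normalize where "normalize \<rho> = (\<lambda>x\<in>V. S \<rho> *v \<rho> x)" for \<rho>
  have restricted: "realization V (normalize \<rho>) \<and> compatible E lam (normalize \<rho>)" if "\<rho> \<in> R" for \<rho>
    using SO3C_restrict_realization[OF graph rotation[OF that], of \<rho> lam] compatible[OF that]
    by (simp add: normalize_def)
  show thesis
  proof (rule that[OF edge, of "normalize ` R"])
    show "infinite (normalize ` R)"
      using inj_on_rotate_essentially_distinct[OF distinct rotation] \<open>infinite R\<close>
      by (simp add: normalize_def[abs_def] finite_image_iff)
    show "normalize ` R \<subseteq> extensional V" by (auto simp: normalize_def)
    show "realization V \<rho>' \<and> compatible E lam \<rho>' \<and> \<rho>' a = axis 3 1 \<and> \<rho>' b = tilted_pole c"
      if "\<rho>' \<in> normalize ` R" for \<rho>'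
      using that restricted normal vertices by (auto simp: normalize_def)
  qed
qed

lemma flexible_assignment_moving_path:
  assumes graph: "simple_graph V E" and connected: "connected_graph V E"
    and "flexible_assignment V E lam"
  obtains p q s T U Q where "{p, q} \<in> E" "{q, s} \<in> E" "infinite ((\<lambda>\<rho>. \<rho> s) ` Q)"
    "\<And>\<rho>. \<rho> \<in> Q \<Longrightarrow> realization V \<rho> \<and> compatible E lam \<rho> \<and> \<rho> p = T \<and> \<rho> q = U"
proof -
  obtain a b T\<^sub>0 U\<^sub>0 Q where edge: "{a, b} \<in> E" and many: "infinite Q" "Q \<subseteq> extensional V"
    and normalized: "\<And>\<rho>. \<rho> \<in> Q \<Longrightarrow> realization V \<rho> \<and> compatible E lam \<rho> \<and> \<rho> a = T\<^sub>0 \<and> \<rho> b = U\<^sub>0"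
    by (rule flexible_assignment_normalized[OF assms]) blast
  define bounded where "bounded x \<longleftrightarrow> finite ((\<lambda>\<rho>. \<rho> x) ` Q)" for x
  have "(\<lambda>\<rho>. \<rho> a) ` Q \<subseteq> {T\<^sub>0}" "(\<lambda>\<rho>. \<rho> b) ` Q \<subseteq> {U\<^sub>0}" using normalized by auto
  then have "bounded a" "bounded b" unfolding bounded_def by (auto dest: finite_subset)
  moreover obtain t where "t \<in> V" "\<not> bounded t"
    using infinite_extensional_component[OF _ many(2,1)] graph
    unfolding bounded_def simple_graph_def by blast
  ultimately obtain p q s where path: "{p, q} \<in> E" "{q, s} \<in> E"
    and resting: "finite ((\<lambda>\<rho>. \<rho> p) ` Q)" "finite ((\<lambda>\<rho>. \<rho> q) ` Q)"
    and moving: "infinite ((\<lambda>\<rho>. \<rho> s) ` Q)"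
    using connected_graph_exit_path[OF connected edge, of bounded t] simple_graph_edgeD[OF graph edge]
    unfolding bounded_def by metis
  have "(\<lambda>\<rho>. (\<rho> p, \<rho> q)) ` Q \<subseteq> (\<lambda>\<rho>. \<rho> p) ` Q \<times> (\<lambda>\<rho>. \<rho> q) ` Q" by blast
  then have "finite ((\<lambda>\<rho>. (\<rho> p, \<rho> q)) ` Q)" using resting by (meson finite_SigmaI finite_subset)
  then obtain positions where fiber: "infinite ((\<lambda>\<rho>. \<rho> s) ` {\<rho> \<in> Q. (\<rho> p, \<rho> q) = positions})"
    by (rule infinite_image_fiber[OF moving])
  show thesis
    by (rule that[OF path fiber, of "fst positions" "snd positions"]) (use normalized in auto)
qed

lemma flexible_assignment_moving_path_at_pole:
  assumes graph: "simple_graph V E" and "connected_graph V E" "flexible_assignment V E lam"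
  obtains p q s T Q where "{p, q} \<in> E" "{q, s} \<in> E" "infinite ((\<lambda>\<rho>. \<rho> s) ` Q)"
    "\<And>\<rho>. \<rho> \<in> Q \<Longrightarrow> realization V \<rho> \<and> compatible E lam \<rho> \<and> \<rho> p = T \<and> \<rho> q = axis 3 1"
proof -
  obtain p q s T U Q where path: "{p, q} \<in> E" "{q, s} \<in> E" and moving: "infinite ((\<lambda>\<rho>. \<rho> s) ` Q)"
    and compatible: "\<And>\<rho>. \<rho> \<in> Q \<Longrightarrow> realization V \<rho> \<and> compatible E lam \<rho> \<and> \<rho> p = T \<and> \<rho> q = U"
    by (rule flexible_assignment_moving_path[OF assms]) blast
  obtain \<rho>\<^sub>0 where "\<rho>\<^sub>0 \<in> Q" using moving infinite_imp_nonempty by blast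
  then have "U \<in> sphere2C"
    using compatible simple_graph_edgeD[OF graph path(1)] by (auto simp: realization_def)
  then obtain \<sigma> where rotation: "\<sigma> \<in> SO3C" "\<sigma> *v U = axis 3 1" by (rule SO3C_moves_to_axis)
  show thesis
  proof (rule that[OF path])
    have "(\<lambda>\<rho>. \<rho> s) ` (\<lambda>\<rho> x. \<sigma> *v \<rho> x) ` Q = (*v) \<sigma> ` (\<lambda>\<rho>. \<rho> s) ` Q" by (simp add: image_image)
    then show "infinite ((\<lambda>\<rho>. \<rho> s) ` (\<lambda>\<rho> x. \<sigma> *v \<rho> x) ` Q)"
      using moving SO3C_inj[OF rotation(1)] by (simp add: finite_image_iff inj_on_subset)
    show "realization V \<rho> \<and> compatible E lam \<rho> \<and> \<rho> p = \<sigma> *v T \<and> \<rho> q = axis 3 1"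
      if "\<rho> \<in> (\<lambda>\<rho> x. \<sigma> *v \<rho> x) ` Q" for \<rho>
      using that compatible rotation by (auto simp: SO3C_realization SO3C_compatible)
  qed
qed

lemma infinite_image_sequence:
  assumes "infinite (g ` Q)"
  obtains f :: "nat \<Rightarrow> 'a" where "range f \<subseteq> Q" "inj (\<lambda>n. g (f n))"
proof -
  obtain h :: "nat \<Rightarrow> 'b" where values_sequence: "inj h" "range h \<subseteq> g ` Q"
    using infinite_countable_subset[OF assms] by blast
  then have in_image: "h n \<in> g ` Q" for n by blast
  show thesis
  proof
    show "range (\<lambda>n. inv_into Q g (h n)) \<subseteq> Q" using inv_into_into[OF in_image] by blast
    show "inj (\<lambda>n. g (inv_into Q g (h n)))"
      using values_sequence(1) by (simp add: f_inv_into_f[OF in_image])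
  qed
qed

text \<open>A sequence of complex numbers is 0 or a unit in the ring of sequences only if its zeros do not
  depend on the index, hence the passage to a constant zero pattern.\<close>

definition zero_pattern :: "'v set \<Rightarrow> ('v \<Rightarrow> complex ^ 3) \<Rightarrow> 'v set \<times> 'v set \<times> 'v set" where
  "zero_pattern V \<rho> = ({x \<in> V. iso_u (\<rho> x) = 0}, {x \<in> V. iso_w (\<rho> x) = 0}, {x \<in> V. \<rho> x $ 3 = 0})"

lemma finite_zero_patterns:
  assumes "finite V"
  shows "finite (zero_pattern V ` Q)"
proof (rule finite_subset)
  show "zero_pattern V ` Q \<subseteq> Pow V \<times> Pow V \<times> Pow V" by (auto simp: zero_pattern_def)
qed (use assms in simp)

lemma flexible_imp_NAP_coloring:
  assumes graph: "simple_graph V E" and "connected_graph V E"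
    and flexible: "flexible_assignment V E lam"
  shows "\<exists>\<epsilon>. NAP_coloring E \<epsilon>"
proof -
  have assignment: "assignment E lam" using flexible by (simp add: flexible_assignment_def)
  obtain p q s T Q where path: "{p, q} \<in> E" "{q, s} \<in> E" and moving: "infinite ((\<lambda>\<rho>. \<rho> s) ` Q)"
    and compatible: "\<And>\<rho>. \<rho> \<in> Q \<Longrightarrow> realization V \<rho> \<and> compatible E lam \<rho> \<and> \<rho> p = T \<and> \<rho> q = axis 3 1"
    by (rule flexible_assignment_moving_path_at_pole[OF assms]) blast
  define c where "c = 1 - 2 * lam {q, s}"
  have "c\<^sup>2 \<noteq> 1" using assignment path(2) by (simp add: assignment_iff c_def)
  have "\<rho> s \<in> {T \<in> sphere2C. T $ 3 = c}" if "\<rho> \<in> Q" for \<rho>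
  proof -
    have "\<rho> s \<in> sphere2C" "\<rho> q = axis 3 1"
      using compatible[OF that] simple_graph_edgeD[OF graph path(2)] by (simp_all add: realization_def)
    moreover have "bilin (\<rho> q) (\<rho> s) = c"
      using compatible[OF that] path(2) unfolding compatible_iff c_def by blast
    ultimately show ?thesis using bilin_commute[of "\<rho> q" "\<rho> s"] by (simp add: bilin_axis)
  qed
  then have "inj_on iso_u ((\<lambda>\<rho>. \<rho> s) ` Q)"
    using inj_on_iso_u[OF \<open>c\<^sup>2 \<noteq> 1\<close>] by (blast intro: inj_on_subset)
  then have "infinite ((\<lambda>\<rho>. iso_u (\<rho> s)) ` Q)"
    using moving by (metis (no_types) finite_image_iff image_image)
  moreover have "finite (zero_pattern V ` Q)"
    using graph by (simp add: simple_graph_def finite_zero_patterns)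
  ultimately obtain pattern where "infinite ((\<lambda>\<rho>. iso_u (\<rho> s)) ` {\<rho> \<in> Q. zero_pattern V \<rho> = pattern})"
    by (rule infinite_image_fiber)
  then obtain f :: "nat \<Rightarrow> _" where in_fiber: "range f \<subseteq> {\<rho> \<in> Q. zero_pattern V \<rho> = pattern}"
    and injective: "inj (\<lambda>n. iso_u (f n s))"
    by (rule infinite_image_sequence)
  have in_Q: "f n \<in> Q" and "zero_pattern V (f n) = pattern" for n using in_fiber by auto
  then have "zero_pattern V (f m) = zero_pattern V (f n)" for m n by simp
  then have zeros: "iso_u (f m x) = 0 \<longleftrightarrow> iso_u (f n x) = 0" "iso_w (f m x) = 0 \<longleftrightarrow> iso_w (f n x) = 0"
    "f m x $ 3 = 0 \<longleftrightarrow> f n x $ 3 = 0" if "x \<in> V" for x m n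
    using that unfolding zero_pattern_def prod.inject by blast+
  show ?thesis
  proof (rule degenerating_sequence_NAP_coloring[OF graph assignment _ _ path _ _ _ zeros])
    show "infinite (range (\<lambda>n. iso_u (f n s)))" using injective finite_imageD by blast
  qed (use compatible[OF in_Q] in auto)
qed

theorem theorem3p14:
  fixes V :: "'v set" and E :: "'v set set"
  assumes "simple_graph V E" and "connected_graph V E"
  shows "(\<exists>lam. flexible_assignment V E lam) \<longleftrightarrow> (\<exists>\<epsilon>. NAP_coloring E \<epsilon>)"
  using NAP_coloring_imp_flexible flexible_imp_NAP_coloring assms by blast

end
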